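(* Let $X,Y$ be locally convex Hausdorff topological vector spaces, let $\varphi\colon X\times Y\to\overline{\mathbb{R}}$ be a generalized polyhedral convex function, let $F\colon X\rightrightarrows Y$ be a generalized polyhedral convex multifunction, and let $\mu\colon X\to\overline{\mathbb{R}}$ be the optimal value function $$\mu(x)=\inf\{\varphi(x,y)\mid y\in F(x)\},\quad x\in X.$$ The function $\mu$ is generalized polyhedral convex if and only if $\mu$ is lower semicontinuous on $X$.
   Context: All vector spaces are real; $\overline{\mathbb{R}}=[-\infty,\infty]$ and $\inf\emptyset=\infty$. A subset $D$ of a locally convex Hausdorff topological vector space $E$ is a generalized polyhedral convex set if there exist finitely many continuous linear functionals $e_i^*\in E^*$, $\alpha_i\in\mathbb{R}$, $i=1,\dots,m$, and a closed affine subspace $L\subset E$ such that $D=\{e\in E\mid e\in L,\ \langle e_i^*,e\rangle\le\alpha_i,\ i=1,\dots,m\}$ (the empty set is included). For $f\colon E\to\overline{\mathbb{R}}$, $\mathrm{epi}\,f=\{(e,\lambda)\in E\times\mathbb{R}\mid f(e)\le\lambda\}$. The function $f$ is lower semicontinuous if $\mathrm{epi}\,f$ is closed in $E\times\mathbb{R}$, and it is a generalized polyhedral convex function if $\mathrm{epi}\,f$ is a generalized polyhedral convex set in $E\times\mathbb{R}$. A multifunction $F\colon X\rightrightarrows Y$ (a map assigning to each $x\in X$ a possibly empty subset $F(x)\subset Y$) is generalized polyhedral convex if its graph $\mathrm{gph}\,F=\{(x,y)\in X\times Y\mid y\in F(x)\}$ is a generalized polyhedral convex set in $X\times Y$. 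*)

theory Defs
  imports "HOL-Analysis.Analysis"
begin

class topological_real_vector = real_vector + topological_ab_group_add +
  assumes tendsto_scaleR_nhds:
    "((\<lambda>p. fst p *\<^sub>R snd p) \<longlongrightarrow> c *\<^sub>R x) (nhds c \<times>\<^sub>F nhds x)"

(* A class axiom cannot mention convex on the type being axiomatized, so its definition is
   written out; see the lemma after the class. *)
class locally_convex_t2_space = topological_real_vector + t2_space +
  assumes locally_convex:
    "open U \<Longrightarrow> 0 \<in> U \<Longrightarrow> \<exists>V. open V \<and> 0 \<in> V \<and> V \<subseteq> U \<and>
       (\<forall>x\<in>V. \<forall>y\<in>V. \<forall>u\<ge>0. \<forall>v\<ge>0. u + v = 1 \<longrightarrow> u *\<^sub>R x + v *\<^sub>R y \<in> V)"

lemma ex_open_convex_subset: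
  fixes U :: "'a::locally_convex_t2_space set"
  assumes "open U" "0 \<in> U"
  shows "\<exists>V. open V \<and> 0 \<in> V \<and> V \<subseteq> U \<and> convex V"
  using locally_convex[OF assms] unfolding convex_def .

lemma tendsto_scaleR_tvs:
  fixes g :: "'b \<Rightarrow> 'a::topological_real_vector"
  assumes "(f \<longlongrightarrow> c) A" "(g \<longlongrightarrow> x) A"
  shows "((\<lambda>z. f z *\<^sub>R g z) \<longlongrightarrow> c *\<^sub>R x) A"
  using filterlim_compose[OF tendsto_scaleR_nhds filterlim_Pair[OF assms]] by simp

instance real_normed_vector \<subseteq> locally_convex_t2_space
proof
  fix c :: real and x :: 'a
  show "((\<lambda>p. fst p *\<^sub>R snd p) \<longlongrightarrow> c *\<^sub>R x) (nhds c \<times>\<^sub>F nhds x)"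
    by (intro tendsto_scaleR filterlim_fst filterlim_snd)
next
  fix U :: "'a set"
  assume "open U" "0 \<in> U"
  then obtain r where "r > 0" "ball 0 r \<subseteq> U"
    using openE by blast
  then show "\<exists>V. open V \<and> 0 \<in> V \<and> V \<subseteq> U \<and>
      (\<forall>x\<in>V. \<forall>y\<in>V. \<forall>u\<ge>0. \<forall>v\<ge>0. u + v = 1 \<longrightarrow> u *\<^sub>R x + v *\<^sub>R y \<in> V)"
    using convex_ball[of "0::'a" r] unfolding convex_def
    by (intro exI[of _ "ball 0 r"]) auto
qed

instance prod :: (topological_monoid_add, topological_monoid_add) topological_monoid_add
proof
  fix a b :: "'a \<times> 'b"
  have "((\<lambda>p. (fst (fst p) + fst (snd p), snd (fst p) + snd (snd p))) \<longlongrightarrow>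
      (fst a + fst b, snd a + snd b)) (nhds a \<times>\<^sub>F nhds b)"
    by (intro tendsto_Pair tendsto_add tendsto_fst tendsto_snd filterlim_fst filterlim_snd)
  then show "((\<lambda>p. fst p + snd p) \<longlongrightarrow> a + b) (nhds a \<times>\<^sub>F nhds b)"
    by (simp add: plus_prod_def)
qed

instance prod :: (topological_group_add, topological_group_add) topological_group_add
proof
  fix a :: "'a \<times> 'b"
  have "((\<lambda>p. (- fst p, - snd p)) \<longlongrightarrow> (- fst a, - snd a)) (nhds a)"
    by (intro tendsto_Pair tendsto_minus tendsto_fst tendsto_snd filterlim_ident)
  then show "(uminus \<longlongrightarrow> - a) (nhds a)"
    by (simp add: uminus_prod_def[abs_def])
qed

instance prod :: (topological_ab_group_add, topological_ab_group_add) topological_ab_group_add ..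

instance prod :: (topological_real_vector, topological_real_vector) topological_real_vector
proof
  fix c :: real and x :: "'a \<times> 'b"
  have "((\<lambda>p. (fst p *\<^sub>R fst (snd p), fst p *\<^sub>R snd (snd p))) \<longlongrightarrow>
      (c *\<^sub>R fst x, c *\<^sub>R snd x)) (nhds c \<times>\<^sub>F nhds x)"
    by (intro tendsto_Pair tendsto_scaleR_tvs tendsto_fst tendsto_snd filterlim_fst filterlim_snd)
  then show "((\<lambda>p. fst p *\<^sub>R snd p) \<longlongrightarrow> c *\<^sub>R x) (nhds c \<times>\<^sub>F nhds x)"
    by (simp add: scaleR_prod_def)
qed

instance prod :: (locally_convex_t2_space, locally_convex_t2_space) locally_convex_t2_space
proof
  fix U :: "('a \<times> 'b) set"
  assume "open U" "0 \<in> U"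
  then obtain A B where AB: "open A" "open B" "0 \<in> A \<times> B" "A \<times> B \<subseteq> U"
    by (rule open_prod_elim)
  then obtain V W where "open V" "0 \<in> V" "V \<subseteq> A" "convex V"
      and "open W" "0 \<in> W" "W \<subseteq> B" "convex W"
    using ex_open_convex_subset[of A] ex_open_convex_subset[of B] by (auto simp: zero_prod_def)
  then have "open (V \<times> W)" "0 \<in> V \<times> W" "V \<times> W \<subseteq> U" "convex (V \<times> W)"
    using AB by (auto simp: open_Times convex_Times zero_prod_def)
  then show "\<exists>V. open V \<and> 0 \<in> V \<and> V \<subseteq> U \<and>
      (\<forall>x\<in>V. \<forall>y\<in>V. \<forall>u\<ge>0. \<forall>v\<ge>0. u + v = 1 \<longrightarrow> u *\<^sub>R x + v *\<^sub>R y \<in> V)"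
    unfolding convex_def[symmetric] by (intro exI[of _ "V \<times> W"] conjI)
qed

definition generalized_polyhedral_convex :: "'e::locally_convex_t2_space set \<Rightarrow> bool" where
  "generalized_polyhedral_convex D \<longleftrightarrow>
     (\<exists>(m::nat) (e :: nat \<Rightarrow> 'e \<Rightarrow> real) (\<alpha> :: nat \<Rightarrow> real) L.
        (\<forall>i\<in>{1..m}. linear (e i) \<and> continuous_on UNIV (e i)) \<and>
        affine L \<and> closed L \<and>
        D = {x. x \<in> L \<and> (\<forall>i\<in>{1..m}. e i x \<le> \<alpha> i)})"

(* The library's epigraph is restricted to real-valued functions. *)
definition epi :: "('e \<Rightarrow> ereal) \<Rightarrow> ('e \<times> real) set" where
  "epi f = {(x, t). f x \<le> ereal t}"

definition lower_semicontinuous :: "('e::locally_convex_t2_space \<Rightarrow> ereal) \<Rightarrow> bool" where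
  "lower_semicontinuous f \<longleftrightarrow> closed (epi f)"

definition generalized_polyhedral_convex_fun ::
    "('e::locally_convex_t2_space \<Rightarrow> ereal) \<Rightarrow> bool" where
  "generalized_polyhedral_convex_fun f \<longleftrightarrow> generalized_polyhedral_convex (epi f)"

definition gph :: "('x \<Rightarrow> 'y set) \<Rightarrow> ('x \<times> 'y) set" where
  "gph F = {(x, y). y \<in> F x}"

definition generalized_polyhedral_convex_multifun ::
    "('x::locally_convex_t2_space \<Rightarrow> 'y::locally_convex_t2_space set) \<Rightarrow> bool" where
  "generalized_polyhedral_convex_multifun F \<longleftrightarrow> generalized_polyhedral_convex (gph F)"

(* Over the empty set the infimum in ereal is top, i.e. \<infinity>. *)
definition optimal_value :: "('x \<times> 'y \<Rightarrow> ereal) \<Rightarrow> ('x \<Rightarrow> 'y set) \<Rightarrow> 'x \<Rightarrow> ereal" where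
  "optimal_value \<phi> F x = (INF y\<in>F x. \<phi> (x, y))"

end

theory Submission
  imports Defs
begin

text \<open>
  A generalized polyhedral convex set is closed, so only one direction needs an argument. Let
  \<open>D\<close> be the set of all \<open>((x, y), t)\<close> with \<open>y \<in> F x\<close> and \<open>\<phi> (x, y) \<le> t\<close>; it is generalized
  polyhedral convex, and its projection along \<open>y\<close> lies between the strict epigraph of \<open>\<mu>\<close> and
  the epigraph. When the epigraph of \<open>\<mu>\<close> is closed it is therefore the closure of that
  projection. To stay in one space, the projection is replaced by the sum \<open>D + V\<close>, where \<open>V\<close> is
  the subspace of the vectors \<open>((0, y), 0)\<close>; the epigraph of \<open>\<mu>\<close> is then the section of the
  closure of \<open>D + V\<close> at \<open>y = 0\<close>.

  What has to be shown is that the closure of \<open>D + V\<close> is generalized polyhedral convex for every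
  subspace \<open>V\<close>. Let \<open>R\<close> be the lineality space of \<open>D\<close>: the directions of its affine space on
  which all constraint functionals vanish. With \<open>M\<close> the closure of \<open>R + V\<close>, continuity of
  addition gives \<open>D + V \<subseteq> D + M \<subseteq> closure (D + V)\<close>, so it suffices that \<open>D + M\<close> is generalized
  polyhedral convex, and in particular closed, whenever \<open>M\<close> is a closed subspace containing
  \<open>R\<close> (\<open>generalized_polyhedral_convex_plus_closed_subspace\<close>).

  Finitely many functionals cut out \<open>R\<close> from the space \<open>S\<close> of directions, so everything between
  \<open>R\<close> and \<open>S\<close> is finite-dimensional modulo \<open>R\<close>. The part of \<open>M\<close> inside \<open>S\<close> thus contributes only
  finitely many directions, which Fourier--Motzkin elimination removes from the inequalities. The
  resulting functionals vanish on \<open>S \<inter> M\<close>, so they extend from \<open>S\<close> to \<open>S + M\<close> by zero on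
  \<open>M\<close>; the Hahn--Banach theorem makes these extensions continuous and globally defined. Together
  with the subspace \<open>S + M\<close>, closed because \<open>M\<close> has finite codimension in it, they describe
  \<open>D + M\<close>.
\<close>

section \<open>Hahn--Banach\<close>

lemma continuous_on_scaleR_tvs:
  fixes g :: "'b::topological_space \<Rightarrow> 'a::topological_real_vector"
  assumes "continuous_on S f" "continuous_on S g"
  shows "continuous_on S (\<lambda>x. f x *\<^sub>R g x)"
  using assms unfolding continuous_on_def by (blast intro: tendsto_scaleR_tvs)

lemma translation_eq_vimage:
  fixes a :: "'a::ab_group_add"
  shows "(+) a ` N = (\<lambda>z. z - a) -` N"
proof -
  have "z \<in> (+) a ` N" if "z - a \<in> N" for z
    using imageI[OF that, of "(+) a"] by simp
  then show ?thesis by auto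
qed

definition continuous_functional :: "('a::topological_real_vector \<Rightarrow> real) \<Rightarrow> bool" where
  "continuous_functional f \<longleftrightarrow> linear f \<and> continuous_on UNIV f"

lemma continuous_functionalD:
  assumes "continuous_functional f"
  shows "linear f" "continuous_on UNIV f"
    "f (x + y) = f x + f y" "f (x - y) = f x - f y" "f (c *\<^sub>R x) = c * f x" "f 0 = 0"
  using assms by (auto simp: continuous_functional_def linear_add linear_diff linear_cmul linear_0)

lemma subspace_chain_Union:
  assumes "subset.chain {H. subspace H} \<C>" "\<C> \<noteq> {}"
  shows "subspace (\<Union>\<C>)"
proof (rule subspaceI)
  have sub: "subspace H" if "H \<in> \<C>" for H
    using assms(1) that by (auto simp: subset.chain_def)
  show "0 \<in> \<Union>\<C>"
    using assms(2) sub subspace_0 by blast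
  show "c *\<^sub>R x \<in> \<Union>\<C>" if "x \<in> \<Union>\<C>" for c x
    using that sub subspace_scale by blast
  fix x y assume "x \<in> \<Union>\<C>" "y \<in> \<Union>\<C>"
  then obtain H K where H: "H \<in> \<C>" "K \<in> \<C>" "x \<in> H" "y \<in> K" by blast
  then have "H \<subseteq> K \<or> K \<subseteq> H"
    using assms(1) by (auto simp: subset.chain_def)
  with H show "x + y \<in> \<Union>\<C>"
    using sub subspace_add by blast
qed

text \<open>
  The geometric Hahn--Banach theorem. For a maximal subspace \<open>H\<close> that contains \<open>M\<close> and misses
  \<open>A\<close>, the open convex cone \<open>C = H + (0, \<infinity>) A\<close> and its negative cover everything outside \<open>H\<close>,
  since a vector in neither could be added to \<open>H\<close>. The line through any \<open>z\<close> in direction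
  \<open>w\<close> starts in one of the two cones and ends in the other, so by connectedness it meets \<open>H\<close>:
  \<open>H\<close> is a hyperplane complementary to \<open>w\<close>. The functional is the coordinate along \<open>w\<close>, and
  its strict half-spaces are translates of \<open>C\<close> and \<open>- C\<close>, hence open.
\<close>

lemma functional_vanishing_off_open_convex:
  fixes A :: "'a::topological_real_vector set"
  assumes A: "open A" "convex A" "w \<in> A" and M: "subspace M" "M \<inter> A = {}"
  shows "\<exists>f. continuous_functional f \<and> (\<forall>x\<in>M. f x = 0) \<and> f w = 1"
proof -
  define \<H> where "\<H> = {H. subspace H \<and> M \<subseteq> H \<and> H \<inter> A = {}}"
  have "\<exists>H\<in>\<H>. \<forall>K\<in>\<H>. H \<subseteq> K \<longrightarrow> K = H"
  proof (rule subset_Zorn_nonempty)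
    show "\<H> \<noteq> {}" using M by (auto simp: \<H>_def)
    fix \<C> assume \<C>: "\<C> \<noteq> {}" "subset.chain \<H> \<C>"
    then have "subset.chain {H. subspace H} \<C>"
      by (auto simp: subset.chain_def \<H>_def)
    from subspace_chain_Union[OF this \<C>(1)] show "\<Union>\<C> \<in> \<H>"
      using \<C> by (auto simp: \<H>_def subset.chain_def)
  qed
  then obtain H where "H \<in> \<H>" and maximal: "\<And>K. K \<in> \<H> \<Longrightarrow> H \<subseteq> K \<Longrightarrow> K = H" by blast
  then have H: "subspace H" "M \<subseteq> H" "H \<inter> A = {}" by (auto simp: \<H>_def)
  define C where "C = {h + s *\<^sub>R a | h s a. h \<in> H \<and> 0 < s \<and> a \<in> A}"
  have CI: "x \<in> C" if "h \<in> H" "0 < s" "a \<in> A" "x = h + s *\<^sub>R a" for h s a x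
    using that by (auto simp: C_def)
  have CE: "\<exists>h s a. h \<in> H \<and> 0 < s \<and> a \<in> A \<and> x = h + s *\<^sub>R a" if "x \<in> C" for x
    using that by (auto simp: C_def)
  have openC: "open C"
  proof -
    have "C = (\<Union>h\<in>H. \<Union>s\<in>{0<..}. (\<lambda>x. (1/s) *\<^sub>R (x - h)) -` A)" (is "_ = ?U")
    proof (intro equalityI subsetI)
      fix x assume "x \<in> C"
      then obtain h s a where hsa: "h \<in> H" "0 < s" "a \<in> A" "x = h + s *\<^sub>R a" using CE by blast
      then have "(1/s) *\<^sub>R (x - h) = a" by simp
      then have "x \<in> (\<lambda>x. (1/s) *\<^sub>R (x - h)) -` A" using hsa by simp
      then show "x \<in> ?U" using hsa(1,2) by blast
    next
      fix x assume "x \<in> ?U"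
      then obtain h s where hs: "h \<in> H" "0 < s" "(1/s) *\<^sub>R (x - h) \<in> A" by auto
      then show "x \<in> C" by (intro CI[of h s "(1/s) *\<^sub>R (x - h)"]) auto
    qed
    moreover have "open ?U"
      by (intro open_UN ballI open_vimage A continuous_on_scaleR_tvs continuous_intros)
    ultimately show ?thesis by simp
  qed
  have C_add: "x + y \<in> C" if "x \<in> C" "y \<in> C" for x y
  proof -
    obtain h s a where 1: "h \<in> H" "0 < s" "a \<in> A" "x = h + s *\<^sub>R a" using CE \<open>x \<in> C\<close> by blast
    obtain k t b where 2: "k \<in> H" "0 < t" "b \<in> A" "y = k + t *\<^sub>R b" using CE \<open>y \<in> C\<close> by blast
    have "(s/(s+t)) *\<^sub>R a + (t/(s+t)) *\<^sub>R b \<in> A"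
      using 1 2 by (intro convexD[OF A(2)]) (auto simp flip: add_divide_distrib)
    then show ?thesis
      using 1 2 H(1)
      by (intro CI[of "h + k" "s + t" "(s/(s+t)) *\<^sub>R a + (t/(s+t)) *\<^sub>R b"])
        (auto simp: subspace_add scaleR_add_right)
  qed
  have C_scale: "r *\<^sub>R x \<in> C" if "x \<in> C" "0 < r" for x r
  proof -
    obtain h s a where "h \<in> H" "0 < s" "a \<in> A" "x = h + s *\<^sub>R a" using CE \<open>x \<in> C\<close> by blast
    then show ?thesis
      using H(1) \<open>0 < r\<close>
      by (intro CI[of "r *\<^sub>R h" "r * s" a]) (auto simp: subspace_scale scaleR_add_right)
  qed
  have C_H: "h + x \<in> C" if "x \<in> C" "h \<in> H" for x h
  proof -
    obtain k s a where "k \<in> H" "0 < s" "a \<in> A" "x = k + s *\<^sub>R a" using CE \<open>x \<in> C\<close> by blast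
    then show ?thesis
      using H(1) \<open>h \<in> H\<close> by (intro CI[of "h + k" s a]) (auto simp: subspace_add)
  qed
  have zero_C: "0 \<notin> C"
  proof
    assume "0 \<in> C"
    then obtain h s a where hsa: "h \<in> H" "0 < s" "a \<in> A" "0 = h + s *\<^sub>R a" using CE by blast
    then have "a = (- 1/s) *\<^sub>R h"
      using hsa(2) by (simp add: eq_neg_iff_add_eq_0[symmetric])
    then have "a \<in> H" using hsa(1) H(1) subspace_scale by blast
    then show False using hsa H(3) by blast
  qed
  have H_C: "x \<notin> C" if "x \<in> H" for x
    using C_H[of x "- x"] zero_C subspace_neg[OF H(1) that] by auto
  have C_neg: "- x \<notin> C" if "x \<in> C" for x
    using C_add[of x "- x"] zero_C that by auto
  have w: "w \<in> C" by (rule CI[of 0 1 w]) (use A H(1) in \<open>auto simp: subspace_0\<close>)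
  have wH: "w \<notin> H" using A(3) H(3) by blast
  have cover: "x \<in> H \<or> x \<in> C \<or> - x \<in> C" for x
  proof (rule ccontr)
    assume *: "\<not> (x \<in> H \<or> x \<in> C \<or> - x \<in> C)"
    have sup: "H \<subseteq> span (insert x H)" by (meson span_superset subset_insertI subset_trans)
    have "x \<in> span (insert x H)" by (simp add: span_base)
    then have "span (insert x H) \<noteq> H" using * by auto
    then have "span (insert x H) \<notin> \<H>" using maximal sup by blast
    then obtain y where y: "y \<in> A" "y \<in> span (insert x H)"
      using sup H(2) by (auto simp: \<H>_def)
    then obtain k where k: "y - k *\<^sub>R x \<in> H"
      using H(1) by (metis span_breakdown_eq span_eq_iff)
    define h where "h = y - k *\<^sub>R x"
    have h: "h \<in> H" "y = h + k *\<^sub>R x" using k by (auto simp: h_def)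
    consider "k = 0" | "k > 0" | "k < 0" by linarith
    then show False
    proof cases
      case 1
      then show ?thesis using h y H(3) by auto
    next
      case 2
      have "x = (- 1/k) *\<^sub>R h + (1/k) *\<^sub>R y"
        using 2 by (simp add: h(2) scaleR_add_right)
      then have "x \<in> C" using 2 h y H(1) by (intro CI[of "(- 1/k) *\<^sub>R h" "1/k" y]) (auto simp: subspace_scale subspace_neg)
      then show ?thesis using * by blast
    next
      case 3
      have "- x = (1/k) *\<^sub>R h + (-1/k) *\<^sub>R y"
        using 3 by (simp add: h(2) scaleR_add_right)
      then have "- x \<in> C" using 3 h y H(1)
        by (intro CI[of "(1/k) *\<^sub>R h" "-1/k" y]) (auto simp: subspace_scale)
      then show ?thesis using * by blast
    qed
  qed
  \<comment> \<open>\<open>C\<close> is open around \<open>w\<close>, so it contains \<open>w + r z\<close> for small \<open>r\<close>; divide by \<open>r\<close>.\<close>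
  have absorb: "\<exists>s>0. z + s *\<^sub>R w \<in> C" for z
  proof -
    have "open ((\<lambda>r::real. w + r *\<^sub>R z) -` C)"
      by (intro open_vimage openC continuous_intros continuous_on_scaleR_tvs)
    moreover have "0 \<in> (\<lambda>r::real. w + r *\<^sub>R z) -` C" using w by simp
    ultimately obtain e where e: "e > 0" "ball 0 e \<subseteq> (\<lambda>r::real. w + r *\<^sub>R z) -` C"
      using openE by blast
    then have "w + (e/2) *\<^sub>R z \<in> C" by (auto simp: subset_iff dist_real_def)
    from C_scale[OF this, of "2/e"] e(1) show ?thesis
      by (intro exI[of _ "2/e"]) (auto simp: scaleR_add_right add.commute)
  qed
  have "\<exists>t. z - t *\<^sub>R w \<in> H" for z
  proof (rule ccontr)
    assume none: "\<nexists>t. z - t *\<^sub>R w \<in> H"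
    define P where "P = (\<lambda>t. z - t *\<^sub>R w) -` C"
    define Q where "Q = (\<lambda>t. - (z - t *\<^sub>R w)) -` C"
    have "open P" "open Q" unfolding P_def Q_def
      by (intro open_vimage openC continuous_intros continuous_on_scaleR_tvs)+
    moreover have "P \<inter> Q = {}" using C_neg unfolding P_def Q_def by blast
    moreover have "UNIV \<subseteq> P \<union> Q" using none cover unfolding P_def Q_def by blast
    moreover obtain s where "z + s *\<^sub>R w \<in> C" using absorb by blast
    then have "- s \<in> P" by (simp add: P_def)
    moreover obtain r where "- z + r *\<^sub>R w \<in> C" using absorb by blast
    then have "r \<in> Q" by (simp add: Q_def)
    ultimately show False
      using connected_UNIV[where 'a=real, unfolded connected_def] by blast
  qed
  then obtain f where f: "\<And>z. z - f z *\<^sub>R w \<in> H" by metis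
  have unique: "f z = t" if "z - t *\<^sub>R w \<in> H" for z t
  proof (rule ccontr)
    assume "f z \<noteq> t"
    have "(z - t *\<^sub>R w) - (z - f z *\<^sub>R w) \<in> H" using H(1) that f subspace_diff by blast
    then have "(f z - t) *\<^sub>R w \<in> H" by (simp add: scaleR_diff_left)
    then have "(1 / (f z - t)) *\<^sub>R ((f z - t) *\<^sub>R w) \<in> H" using H(1) subspace_scale by blast
    with \<open>f z \<noteq> t\<close> wH show False by simp
  qed
  have lin: "linear f"
  proof (rule linearI)
    fix x y c
    have "(x - f x *\<^sub>R w) + (y - f y *\<^sub>R w) \<in> H" using f H(1) subspace_add by blast
    then show "f (x + y) = f x + f y"
      by (intro unique) (simp add: algebra_simps)
    have "c *\<^sub>R (x - f x *\<^sub>R w) \<in> H" using f H(1) subspace_scale by blast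
    then show "f (c *\<^sub>R x) = c *\<^sub>R f x"
      by (intro unique) (simp add: algebra_simps)
  qed
  have split: "z - c *\<^sub>R w = (z - f z *\<^sub>R w) + (f z - c) *\<^sub>R w" for z c
    by (simp add: algebra_simps)
  have less: "z - c *\<^sub>R w \<in> C" if "c < f z" for z c
    by (subst split) (intro C_H C_scale w f, use that in simp)
  have greater: "- (z - c *\<^sub>R w) \<in> C" if "f z < c" for z c
  proof -
    have "- (z - c *\<^sub>R w) = - (z - f z *\<^sub>R w) + (c - f z) *\<^sub>R w"
      by (simp add: algebra_simps)
    then show ?thesis
      by (simp only:) (intro C_H C_scale w subspace_neg[OF H(1)] f, use that in simp)
  qed
  have gt_iff: "c < f z \<longleftrightarrow> z - c *\<^sub>R w \<in> C" for z c
  proof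
    assume *: "z - c *\<^sub>R w \<in> C"
    show "c < f z"
      using greater[of z c] C_neg[OF *] H_C[OF f, of z] *
      by (cases "f z" c rule: linorder_cases) auto
  qed (rule less)
  have lt_iff: "f z < c \<longleftrightarrow> - (z - c *\<^sub>R w) \<in> C" for z c
  proof
    assume *: "- (z - c *\<^sub>R w) \<in> C"
    show "f z < c"
      using less[of c z] C_neg[OF *] H_C[OF subspace_neg[OF H(1) f], of z] *
      by (cases "f z" c rule: linorder_cases) auto
  qed (rule greater)
  have "continuous_on UNIV f" unfolding continuous_on_def
  proof (intro ballI order_tendstoI)
    fix x c assume "c < f x"
    moreover have "open ((\<lambda>z. z - c *\<^sub>R w) -` C)"
      by (intro open_vimage openC continuous_intros)
    ultimately show "\<forall>\<^sub>F z in at x. c < f z"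
      unfolding eventually_at_topological gt_iff by (intro exI conjI) auto
  next
    fix x c assume "f x < c"
    moreover have "open ((\<lambda>z. - (z - c *\<^sub>R w)) -` C)"
      by (intro open_vimage openC continuous_intros)
    ultimately show "\<forall>\<^sub>F z in at x. f z < c"
      unfolding eventually_at_topological lt_iff by (intro exI conjI) auto
  qed
  moreover have "f x = 0" if "x \<in> M" for x
    using that H(2) by (intro unique) auto
  moreover have "f w = 1" using H(1) by (intro unique) (simp add: subspace_0)
  ultimately show ?thesis using lin unfolding continuous_functional_def by blast
qed

lemma functional_vanishing_on_closed_subspace:
  fixes M :: "'a::locally_convex_t2_space set"
  assumes "subspace M" "closed M" "w \<notin> M"
  shows "\<exists>f. continuous_functional f \<and> (\<forall>x\<in>M. f x = 0) \<and> f w = 1"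
proof -
  have "open ((\<lambda>u. w + u) -` (- M))"
    using assms by (intro open_vimage continuous_intros) auto
  moreover have "0 \<in> (\<lambda>u. w + u) -` (- M)" using assms by simp
  ultimately obtain V where V: "open V" "0 \<in> V" "V \<subseteq> (\<lambda>u. w + u) -` (- M)" "convex V"
    using ex_open_convex_subset by blast
  have "open ((\<lambda>x. x - w) -` V)" by (intro open_vimage V continuous_intros)
  then have "open ((+) w ` V)" by (simp add: translation_eq_vimage)
  then show ?thesis
    using V assms(1)
    by (intro functional_vanishing_off_open_convex[of "(+) w ` V"]) (auto simp: convex_translation)
qed

section \<open>Subspaces of finite codimension\<close>

text \<open>
  Adding one vector \<open>b\<close> outside a closed subspace \<open>N\<close> keeps it closed: a continuous functional
  \<open>f\<close> that vanishes on \<open>N\<close> with \<open>f b = 1\<close> recovers the coefficient of \<open>b\<close>, so the sum is the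
  preimage of \<open>N\<close> under \<open>z \<mapsto> z - f z b\<close>.
\<close>

lemma closed_plus_span_finite:
  fixes M :: "'a::locally_convex_t2_space set"
  assumes "finite B" "subspace M" "closed M"
  shows "closed {x + y | x y. x \<in> M \<and> y \<in> span B}"
  using assms
proof (induction B)
  case empty
  then show ?case by simp
next
  case (insert b B)
  define N where "N = {x + y | x y. x \<in> M \<and> y \<in> span B}"
  have N: "subspace N" "closed N" using insert by (auto simp: N_def intro: subspace_sums)
  have NI: "x + y \<in> N" if "x \<in> M" "y \<in> span B" for x y using that by (auto simp: N_def)
  have eq: "{x + y | x y. x \<in> M \<and> y \<in> span (insert b B)} = {z. \<exists>k. z - k *\<^sub>R b \<in> N}"
  proof (intro equalityI subsetI; clarify)
    fix x y assume "x \<in> M" "y \<in> span (insert b B)"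
    then obtain k where "y - k *\<^sub>R b \<in> span B" by (metis span_breakdown_eq)
    from NI[OF \<open>x \<in> M\<close> this] show "\<exists>k. x + y - k *\<^sub>R b \<in> N"
      by (metis add_diff_eq)
  next
    fix z k assume "z - k *\<^sub>R b \<in> N"
    then obtain x y where xy: "z - k *\<^sub>R b = x + y" "x \<in> M" "y \<in> span B" by (auto simp: N_def)
    have "(y + k *\<^sub>R b) - k *\<^sub>R b \<in> span B" using xy by simp
    then have "y + k *\<^sub>R b \<in> span (insert b B)" unfolding span_breakdown_eq by blast
    moreover have "z = x + (y + k *\<^sub>R b)" using xy(1) by (simp add: algebra_simps)
    ultimately show "\<exists>x y. z = x + y \<and> x \<in> M \<and> y \<in> span (insert b B)" using xy by blast
  qed
  show ?case
  proof (cases "b \<in> N")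
    case True
    have "z \<in> N" if "z - k *\<^sub>R b \<in> N" for z k
      using subspace_add[OF N(1) that subspace_scale[OF N(1) True, of k]] by simp
    moreover have "z - 0 *\<^sub>R b \<in> N" if "z \<in> N" for z using that by simp
    ultimately have "{z. \<exists>k. z - k *\<^sub>R b \<in> N} = N" by blast
    with N eq show ?thesis by simp
  next
    case False
    obtain f where f: "continuous_functional f" "\<forall>x\<in>N. f x = 0" "f b = 1"
      using functional_vanishing_on_closed_subspace[OF N False] by blast
    have "f z = k" if "z - k *\<^sub>R b \<in> N" for z k
      using f that continuous_functionalD(4,5)[OF f(1)] by fastforce
    then have "{z. \<exists>k. z - k *\<^sub>R b \<in> N} = (\<lambda>z. z - f z *\<^sub>R b) -` N" by auto
    moreover have "closed \<dots>"
      by (intro closed_vimage N continuous_intros continuous_on_scaleR_tvs continuous_functionalD(2) f)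
    ultimately show ?thesis using eq by simp
  qed
qed

lemma subspace_kernel_functional: "subspace S \<Longrightarrow> continuous_functional f \<Longrightarrow> subspace {x \<in> S. f x = 0}"
  by (auto simp: subspace_def continuous_functionalD)

definition common_kernel :: "('a::topological_real_vector \<Rightarrow> real) set \<Rightarrow> 'a set" where
  "common_kernel \<F> = {x. \<forall>f\<in>\<F>. f x = 0}"

lemma subspace_common_kernel:
  "(\<And>f. f \<in> \<F> \<Longrightarrow> continuous_functional f) \<Longrightarrow> subspace (common_kernel \<F>)"
  by (auto simp: subspace_def common_kernel_def continuous_functionalD)

text \<open>
  Each functional lowers the dimension by at most one: unless it already vanishes on what is left,
  a single vector \<open>w\<close> on which it does not vanish corrects its value.
\<close>

lemma finite_codimension_common_kernel:
  assumes "finite \<F>" "\<And>f. f \<in> \<F> \<Longrightarrow> continuous_functional f" "subspace S"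
  shows "\<exists>B. finite B \<and> B \<subseteq> S \<and> S = {x + y | x y. x \<in> S \<inter> common_kernel \<F> \<and> y \<in> span B}"
proof -
  have "\<exists>B. finite B \<and> B \<subseteq> S \<and> (\<forall>z\<in>S. \<exists>y\<in>span B. z - y \<in> common_kernel \<F>)"
    using assms(1,2)
  proof (induction \<F>)
    case empty
    then show ?case by (intro exI[of _ "{}"]) (auto simp: common_kernel_def)
  next
    case (insert f \<F>)
    then obtain B where B: "finite B" "B \<subseteq> S" "\<forall>z\<in>S. \<exists>y\<in>span B. z - y \<in> common_kernel \<F>"
      by auto
    have f: "continuous_functional f" using insert by simp
    have spanB: "span B \<subseteq> S" using B(2) assms(3) by (simp add: span_minimal)
    show ?case
    proof (cases "\<forall>x \<in> S \<inter> common_kernel \<F>. f x = 0")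
      case True
      have "\<exists>y\<in>span B. z - y \<in> common_kernel (insert f \<F>)" if "z \<in> S" for z
      proof -
        obtain y where y: "y \<in> span B" "z - y \<in> common_kernel \<F>" using B(3) \<open>z \<in> S\<close> by blast
        then have "z - y \<in> S" using that spanB by (auto intro: subspace_diff[OF assms(3)])
        with y True show ?thesis by (intro bexI[of _ y]) (auto simp: common_kernel_def)
      qed
      then show ?thesis using B(1,2) by (intro exI[of _ B]) simp
    next
      case False
      then obtain w where w: "w \<in> S" "w \<in> common_kernel \<F>" "f w \<noteq> 0" by blast
      have "\<exists>y\<in>span (insert w B). z - y \<in> common_kernel (insert f \<F>)" if "z \<in> S" for z
      proof -
        obtain y where y: "y \<in> span B" "z - y \<in> common_kernel \<F>" using B(3) \<open>z \<in> S\<close> by blast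
        define k where "k = f (z - y) / f w"
        have "(y + k *\<^sub>R w) - k *\<^sub>R w \<in> span B" using y by simp
        then have "y + k *\<^sub>R w \<in> span (insert w B)" unfolding span_breakdown_eq by blast
        moreover have "subspace (common_kernel \<F>)"
          using insert.prems by (intro subspace_common_kernel) simp
        then have "z - y - k *\<^sub>R w \<in> common_kernel \<F>"
          using y(2) w(2) by (blast intro: subspace_diff subspace_scale)
        moreover have "f (z - y - k *\<^sub>R w) = 0"
          using w by (simp add: continuous_functionalD(4,5)[OF f] k_def)
        ultimately show ?thesis
          by (intro bexI[of _ "y + k *\<^sub>R w"]) (auto simp: common_kernel_def diff_diff_eq)
      qed
      then show ?thesis using B w by (intro exI[of _ "insert w B"]) auto
    qed
  qed
  then obtain B where B: "finite B" "B \<subseteq> S" "\<forall>z\<in>S. \<exists>y\<in>span B. z - y \<in> common_kernel \<F>"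
    by blast
  have spanB: "span B \<subseteq> S" using B(2) assms(3) by (simp add: span_minimal)
  have "S = {x + y | x y. x \<in> S \<inter> common_kernel \<F> \<and> y \<in> span B}"
  proof (intro equalityI subsetI)
    fix z assume z: "z \<in> S"
    then obtain y where y: "y \<in> span B" "z - y \<in> common_kernel \<F>" using B by blast
    then have "z - y \<in> S \<inter> common_kernel \<F>" "z = (z - y) + y"
      using z spanB assms(3) by (auto intro: subspace_diff)
    then show "z \<in> {x + y | x y. x \<in> S \<inter> common_kernel \<F> \<and> y \<in> span B}" using y by blast
  qed (use spanB assms(3) in \<open>auto intro: subspace_add\<close>)
  then show ?thesis using B by blast
qed

text \<open>
  A sum of two closed subspaces need not be closed. Here \<open>M\<close> contains a part of \<open>S\<close> of finite
  codimension, so the sum is \<open>M\<close> plus a finite-dimensional space.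
\<close>

lemma closed_plus_finite_codimension:
  fixes M :: "'a::locally_convex_t2_space set"
  assumes "finite \<F>" "\<And>f. f \<in> \<F> \<Longrightarrow> continuous_functional f" "subspace S"
    and M: "subspace M" "closed M" and "S \<inter> common_kernel \<F> \<subseteq> M"
  shows "closed {x + y | x y. x \<in> S \<and> y \<in> M}"
proof -
  obtain B where B: "finite B" "B \<subseteq> S"
    "S = {x + y | x y. x \<in> S \<inter> common_kernel \<F> \<and> y \<in> span B}"
    using finite_codimension_common_kernel[OF assms(1-3)] by blast
  have spanB: "span B \<subseteq> S" using B(2) assms(3) by (simp add: span_minimal)
  have "{x + y | x y. x \<in> S \<and> y \<in> M} = {x + y | x y. x \<in> M \<and> y \<in> span B}"
  proof (intro equalityI subsetI; clarify)
    fix x m assume "x \<in> S" "m \<in> M"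
    then obtain k y where "x = k + y" "k \<in> S \<inter> common_kernel \<F>" "y \<in> span B"
      using B(3) by blast
    then show "\<exists>x' y'. x + m = x' + y' \<and> x' \<in> M \<and> y' \<in> span B"
      using \<open>m \<in> M\<close> assms(6)
      by (intro exI[of _ "k + m"] exI[of _ y]) (auto intro: subspace_add[OF M(1)])
  next
    fix m y assume "m \<in> M" "y \<in> span B"
    then show "\<exists>x' y'. m + y = x' + y' \<and> x' \<in> S \<and> y' \<in> M"
      using spanB by (intro exI[of _ y] exI[of _ m]) auto
  qed
  with closed_plus_span_finite[OF B(1) M] show ?thesis by simp
qed

text \<open>
  A prescription of \<open>f\<close> on \<open>S\<close> and \<open>0\<close> on \<open>M\<close> is consistent because \<open>f\<close> vanishes on \<open>S \<inter> M\<close>. For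
  continuity, the subspace \<open>N\<close>, the sum of \<open>M\<close> and the kernel of \<open>f\<close> in \<open>S\<close>, is closed because
  the finite family \<open>\<F>\<close> bounds the codimension of \<open>M\<close> in it. A functional that separates \<open>N\<close>
  from some \<open>w \<in> S\<close> with \<open>f w \<noteq> 0\<close> is then the desired extension up to a scalar factor.
\<close>

lemma extend_functional_by_zero:
  fixes M :: "'a::locally_convex_t2_space set"
  assumes "finite \<F>" "\<And>f. f \<in> \<F> \<Longrightarrow> continuous_functional f" "subspace S"
    and M: "subspace M" "closed M" "S \<inter> common_kernel \<F> \<subseteq> M"
    and f: "continuous_functional f" "\<forall>x \<in> S \<inter> M. f x = 0"
  shows "\<exists>g. continuous_functional g \<and> (\<forall>x\<in>M. g x = 0) \<and> (\<forall>x\<in>S. g x = f x)"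
proof (cases "\<forall>x\<in>S. f x = 0")
  case True
  then show ?thesis
    by (intro exI[of _ "\<lambda>_. 0"]) (auto simp: continuous_functional_def linear_iff)
next
  case False
  then obtain w where w: "w \<in> S" "f w \<noteq> 0" by blast
  define K where "K = {x \<in> S. f x = 0}"
  have K: "subspace K" unfolding K_def using assms(3) f(1) by (rule subspace_kernel_functional)
  define N where "N = {x + y | x y. x \<in> K \<and> y \<in> M}"
  have "subspace N" unfolding N_def using K M(1) by (rule subspace_sums)
  moreover have "closed N" unfolding N_def
    using closed_plus_finite_codimension[OF assms(1,2) K M(1,2)] M(3) by (auto simp: K_def)
  moreover have "w \<notin> N"
  proof
    assume "w \<in> N"
    then obtain k m where km: "w = k + m" "k \<in> S" "f k = 0" "m \<in> M" by (auto simp: N_def K_def)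
    then have "m \<in> S" using w subspace_diff[OF assms(3) w(1) km(2)] by simp
    then show False using km w f continuous_functionalD(3)[OF f(1)] by auto
  qed
  ultimately obtain g where g: "continuous_functional g" "\<forall>x\<in>N. g x = 0" "g w = 1"
    using functional_vanishing_on_closed_subspace by blast
  have KN: "x \<in> N" if "x \<in> K" for x
    using that subspace_0[OF M(1)] by (force simp: N_def)
  have MN: "x \<in> N" if "x \<in> M" for x
    using that subspace_0[OF K] by (force simp: N_def)
  have "f w * g x = f x" if "x \<in> S" for x
  proof -
    have "x - (f x / f w) *\<^sub>R w \<in> K"
      using that w assms(3) by (auto simp: K_def continuous_functionalD[OF f(1)] intro!: subspace_diff subspace_scale)
    then have "g x - (f x / f w) * g w = 0"
      using g(2) KN continuous_functionalD(4,5)[OF g(1)] by metis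
    then show ?thesis using g(3) w by simp
  qed
  moreover have "continuous_functional (\<lambda>x. f w * g x)"
    using g(1) unfolding continuous_functional_def
    by (auto simp: linear_iff algebra_simps intro!: continuous_intros)
  ultimately show ?thesis using g MN by (intro exI[of _ "\<lambda>x. f w * g x"]) auto
qed

section \<open>Fourier--Motzkin elimination\<close>

definition constraints :: "(('a::topological_real_vector \<Rightarrow> real) \<times> real) set \<Rightarrow> bool" where
  "constraints I \<longleftrightarrow> finite I \<and> (\<forall>(f, c)\<in>I. continuous_functional f)"

definition solutions :: "(('a::topological_real_vector \<Rightarrow> real) \<times> real) set \<Rightarrow> 'a set" where
  "solutions I = {x. \<forall>(f, c)\<in>I. f x \<le> c}"

lemma constraintsD:
  assumes "constraints I"
  shows "finite I" "finite (fst ` I)" "\<And>f. f \<in> fst ` I \<Longrightarrow> continuous_functional f"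
    "\<And>f c. (f, c) \<in> I \<Longrightarrow> continuous_functional f"
  using assms by (auto simp: constraints_def)

lemma exists_between_finite:
  fixes A B :: "real set"
  assumes "finite A" "finite B" "\<And>a b. a \<in> A \<Longrightarrow> b \<in> B \<Longrightarrow> a \<le> b"
  shows "\<exists>t. (\<forall>a\<in>A. a \<le> t) \<and> (\<forall>b\<in>B. t \<le> b)"
proof (cases "A = {}")
  case True
  then show ?thesis using assms(2) by (cases "B = {}") (auto intro!: exI[of _ "Min B"])
next
  case False
  then show ?thesis using assms by (intro exI[of _ "Max A"]) auto
qed

text \<open>
  A constraint \<open>f z + t f v \<le> c\<close> bounds \<open>t\<close> from above, from below or not at all, according to
  the sign of \<open>f v\<close>; a feasible \<open>t\<close> exists if and only if every lower bound is at most every upper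
  bound. Cleared of denominators, each comparison is again a linear constraint, whose functional
  \<open>comb\<close> combines the two so that it vanishes at \<open>v\<close>. The last conjunct, which says that the new
  functionals vanish at \<open>v\<close> and wherever all old ones do, is what later permits their
  extension by zero.
\<close>

lemma Fourier_Motzkin_line:
  fixes v :: "'a::topological_real_vector"
  assumes I: "constraints I"
  shows "\<exists>J. constraints J \<and> (\<forall>z. z \<in> solutions J \<longleftrightarrow> (\<exists>t. z + t *\<^sub>R v \<in> solutions I))
    \<and> insert v (common_kernel (fst ` I)) \<subseteq> common_kernel (fst ` J)"
proof -
  define Z where "Z = {p \<in> I. fst p v = 0}"
  define P where "P = {p \<in> I. fst p v > 0}"
  define N where "N = {p \<in> I. fst p v < 0}"
  define comb :: "('a \<Rightarrow> real) \<times> real \<Rightarrow> ('a \<Rightarrow> real) \<times> real \<Rightarrow> ('a \<Rightarrow> real) \<times> real"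
    where "comb p q = (\<lambda>x. fst p v * fst q x - fst q v * fst p x, fst p v * snd q - fst q v * snd p)"
    for p q
  define J where "J = Z \<union> (\<lambda>(p, q). comb p q) ` (P \<times> N)"
  have func: "continuous_functional (fst p)" if "p \<in> I" for p
    using constraintsD(4)[OF I, of "fst p" "snd p"] that by simp
  have fin: "finite Z" "finite P" "finite N" using constraintsD(1)[OF I] by (auto simp: Z_def P_def N_def)
  have "continuous_functional (fst (comb p q))" if "p \<in> I" "q \<in> I" for p q
    using func[OF that(1)] func[OF that(2)] unfolding continuous_functional_def comb_def
    by (auto simp: linear_iff algebra_simps intro!: continuous_intros)
  then have J: "constraints J"
    using fin func by (auto simp: constraints_def J_def Z_def P_def N_def split: prod.splits) (metis fst_conv)+
  have sol: "z \<in> solutions J \<longleftrightarrow> (\<exists>t. z + t *\<^sub>R v \<in> solutions I)" for z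
  proof -
    define bnd where "bnd p = (snd p - fst p z) / fst p v" for p :: "('a \<Rightarrow> real) \<times> real"
    have I_iff: "z + t *\<^sub>R v \<in> solutions I \<longleftrightarrow>
        (\<forall>p\<in>Z. fst p z \<le> snd p) \<and> (\<forall>p\<in>N. bnd p \<le> t) \<and> (\<forall>p\<in>P. t \<le> bnd p)" for t
    proof -
      have "fst p (z + t *\<^sub>R v) \<le> snd p \<longleftrightarrow> fst p z + t * fst p v \<le> snd p" if "p \<in> I" for p
        using func[OF that] by (simp add: continuous_functionalD)
      moreover have "I = Z \<union> N \<union> P" by (auto simp: Z_def P_def N_def)
      moreover have "fst p z + t * fst p v \<le> snd p \<longleftrightarrow> fst p z \<le> snd p" if "p \<in> Z" for p
        using that by (simp add: Z_def)
      moreover have "fst p z + t * fst p v \<le> snd p \<longleftrightarrow> bnd p \<le> t" if "p \<in> N" for p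
        using that by (auto simp: N_def bnd_def field_simps)
      moreover have "fst p z + t * fst p v \<le> snd p \<longleftrightarrow> t \<le> bnd p" if "p \<in> P" for p
        using that by (auto simp: P_def bnd_def field_simps)
      ultimately show ?thesis
        unfolding solutions_def case_prod_beta mem_Collect_eq by (metis (no_types, lifting) Un_iff)
    qed
    have comb_iff: "fst (comb p q) z \<le> snd (comb p q) \<longleftrightarrow> bnd q \<le> bnd p" if "p \<in> P" "q \<in> N" for p q
      using that by (auto simp: P_def N_def bnd_def comb_def field_simps)
    have "z \<in> solutions J \<longleftrightarrow> (\<forall>p\<in>Z. fst p z \<le> snd p) \<and> (\<forall>p\<in>P. \<forall>q\<in>N. bnd q \<le> bnd p)"
      unfolding solutions_def J_def using comb_iff by (simp add: case_prod_beta ball_Un)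
    also have "\<dots> \<longleftrightarrow> (\<exists>t. z + t *\<^sub>R v \<in> solutions I)"
    proof
      assume *: "(\<forall>p\<in>Z. fst p z \<le> snd p) \<and> (\<forall>p\<in>P. \<forall>q\<in>N. bnd q \<le> bnd p)"
      then obtain t where "\<forall>a\<in>bnd ` N. a \<le> t" "\<forall>b\<in>bnd ` P. t \<le> b"
        using exists_between_finite[of "bnd ` N" "bnd ` P"] fin by auto
      with * show "\<exists>t. z + t *\<^sub>R v \<in> solutions I" unfolding I_iff by auto
    qed (unfold I_iff, meson order_trans)
    finally show ?thesis .
  qed
  have "insert v (common_kernel (fst ` I)) \<subseteq> common_kernel (fst ` J)"
    by (auto simp: common_kernel_def J_def Z_def P_def N_def comb_def)
      (metis fst_conv mult_zero_right)
  with J sol show ?thesis by blast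
qed

lemma Fourier_Motzkin_span:
  fixes B :: "'a::topological_real_vector set"
  assumes "finite B" "constraints I"
  shows "\<exists>J. constraints J \<and> (\<forall>z. z \<in> solutions J \<longleftrightarrow> (\<exists>u\<in>span B. z + u \<in> solutions I))
    \<and> B \<union> common_kernel (fst ` I) \<subseteq> common_kernel (fst ` J)"
  using assms
proof (induction B)
  case empty
  then show ?case by (intro exI[of _ I]) auto
next
  case (insert v B)
  then obtain J where J: "constraints J" "\<And>z. z \<in> solutions J \<longleftrightarrow> (\<exists>u\<in>span B. z + u \<in> solutions I)"
    "B \<union> common_kernel (fst ` I) \<subseteq> common_kernel (fst ` J)" by blast
  obtain K where K: "constraints K" "\<And>z. z \<in> solutions K \<longleftrightarrow> (\<exists>t. z + t *\<^sub>R v \<in> solutions J)"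
    "insert v (common_kernel (fst ` J)) \<subseteq> common_kernel (fst ` K)"
    using Fourier_Motzkin_line[OF J(1)] by blast
  have "(\<exists>t. z + t *\<^sub>R v \<in> solutions J) \<longleftrightarrow> (\<exists>u\<in>span (insert v B). z + u \<in> solutions I)" for z
  proof
    assume "\<exists>t. z + t *\<^sub>R v \<in> solutions J"
    then obtain t u where "u \<in> span B" "z + t *\<^sub>R v + u \<in> solutions I" using J(2) by blast
    moreover from this have "(t *\<^sub>R v + u) - t *\<^sub>R v \<in> span B" by simp
    then have "t *\<^sub>R v + u \<in> span (insert v B)" unfolding span_breakdown_eq by blast
    ultimately show "\<exists>u\<in>span (insert v B). z + u \<in> solutions I"
      by (intro bexI[of _ "t *\<^sub>R v + u"]) (auto simp: add.assoc)
  next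
    assume "\<exists>u\<in>span (insert v B). z + u \<in> solutions I"
    then obtain u where "u \<in> span (insert v B)" and z: "z + u \<in> solutions I" by blast
    then obtain t where "u - t *\<^sub>R v \<in> span B" unfolding span_breakdown_eq by blast
    with z show "\<exists>t. z + t *\<^sub>R v \<in> solutions J"
      unfolding J(2) by (intro exI[of _ t] bexI[of _ "u - t *\<^sub>R v"]) auto
  qed
  then show ?case using K J(3) by (intro exI[of _ K]) auto
qed

section \<open>Generalized polyhedral convex sets\<close>

lemma generalized_polyhedral_convex_iff:
  fixes D :: "'e::locally_convex_t2_space set"
  shows "generalized_polyhedral_convex D \<longleftrightarrow>
    (\<exists>L I. affine L \<and> closed L \<and> constraints I \<and> D = L \<inter> solutions I)"
proof
  assume "generalized_polyhedral_convex D"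
  then obtain m :: nat and e :: "nat \<Rightarrow> 'e \<Rightarrow> real" and \<alpha> L where D: "\<forall>i\<in>{1..m}. linear (e i) \<and> continuous_on UNIV (e i)"
    "affine L" "closed L" "D = {x. x \<in> L \<and> (\<forall>i\<in>{1..m}. e i x \<le> \<alpha> i)}"
    unfolding generalized_polyhedral_convex_def by blast
  then have "constraints ((\<lambda>i. (e i, \<alpha> i)) ` {1..m})"
    "D = L \<inter> solutions ((\<lambda>i. (e i, \<alpha> i)) ` {1..m})"
    by (auto simp: constraints_def continuous_functional_def solutions_def)
  with D show "\<exists>L I. affine L \<and> closed L \<and> constraints I \<and> D = L \<inter> solutions I" by blast
next
  assume "\<exists>L I. affine L \<and> closed L \<and> constraints I \<and> D = L \<inter> solutions I"
  then obtain L I where D: "affine L" "closed L" "constraints I" "D = L \<inter> solutions I" by blast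
  obtain h where "bij_betw h {1..card I} I"
    using ex_bij_betw_nat_finite_1[OF constraintsD(1)[OF D(3)]] by blast
  then have h: "h ` {1..card I} = I" by (rule bij_betw_imp_surj_on)
  have "linear (fst (h i)) \<and> continuous_on UNIV (fst (h i))" if "i \<in> {1..card I}" for i
    using constraintsD(3)[OF D(3), of "fst (h i)"] imageI[OF that, of h] h
    by (simp add: continuous_functional_def)
  moreover have "solutions I = {x. \<forall>i\<in>{1..card I}. fst (h i) x \<le> snd (h i)}"
    unfolding solutions_def case_prod_beta by (subst h[symmetric]) auto
  ultimately show "generalized_polyhedral_convex D"
    unfolding generalized_polyhedral_convex_def using D
    by (intro exI[of _ "card I"] exI[of _ "\<lambda>i. fst (h i)"] exI[of _ "\<lambda>i. snd (h i)"] exI[of _ L]) auto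
qed

lemma generalized_polyhedral_convex_empty: "generalized_polyhedral_convex {}"
  unfolding generalized_polyhedral_convex_iff
  by (intro exI[of _ "{}"]) (auto simp: constraints_def)

lemma closed_solutions:
  assumes "constraints I"
  shows "closed (solutions I)"
proof -
  have "solutions I = (\<Inter>p\<in>I. {x. fst p x \<le> snd p})" by (auto simp: solutions_def case_prod_beta)
  also have "closed \<dots>"
    using constraintsD(3)[OF assms]
    by (intro closed_INT ballI closed_Collect_le continuous_intros continuous_functionalD(2)) auto
  finally show ?thesis .
qed

lemma generalized_polyhedral_convex_imp_closed:
  "generalized_polyhedral_convex D \<Longrightarrow> closed D"
  by (auto simp: generalized_polyhedral_convex_iff closed_solutions)

lemma generalized_polyhedral_convex_Int:
  assumes "generalized_polyhedral_convex C" "generalized_polyhedral_convex D"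
  shows "generalized_polyhedral_convex (C \<inter> D)"
proof -
  obtain K I where C: "affine K" "closed K" "constraints I" "C = K \<inter> solutions I"
    using assms(1) unfolding generalized_polyhedral_convex_iff by blast
  obtain L J where D: "affine L" "closed L" "constraints J" "D = L \<inter> solutions J"
    using assms(2) unfolding generalized_polyhedral_convex_iff by blast
  have "constraints (I \<union> J)" "C \<inter> D = (K \<inter> L) \<inter> solutions (I \<union> J)"
    using C D by (auto simp: constraints_def solutions_def)
  with C D show ?thesis
    unfolding generalized_polyhedral_convex_iff by (blast intro: affine_Int closed_Int)
qed

lemma generalized_polyhedral_convex_vimage:
  assumes D: "generalized_polyhedral_convex D" and T: "linear T" "continuous_on UNIV T"
  shows "generalized_polyhedral_convex (T -` D)"
proof -
  obtain L I where D: "affine L" "closed L" "constraints I" "D = L \<inter> solutions I"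
    using D unfolding generalized_polyhedral_convex_iff by blast
  define J where "J = (\<lambda>(f, c). (f \<circ> T, c)) ` I"
  have "continuous_functional (f \<circ> T)" if "(f, c) \<in> I" for f c
    using constraintsD(4)[OF D(3) that] T unfolding continuous_functional_def
    by (auto simp: o_def intro: continuous_on_compose2[of UNIV f UNIV T] linear_compose[unfolded o_def])
  then have "constraints J" using D(3) by (auto simp: constraints_def J_def)
  moreover have "T -` D = (T -` L) \<inter> solutions J"
    by (auto simp: D(4) J_def solutions_def)
  moreover have "affine (T -` L)"
    using D(1) T(1) by (auto simp: affine_def linear_add linear_cmul)
  moreover have "closed (T -` L)" using D(2) T(2) by (simp add: closed_vimage)
  ultimately show ?thesis unfolding generalized_polyhedral_convex_iff by blast
qed

text \<open>
  The polyhedron consists of the points \<open>d\<close> with \<open>d - a \<in> S\<close> that satisfy \<open>I\<close>, so that \<open>S\<close> is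
  the direction space of its affine part. Eliminating finitely many
  directions \<open>B\<close> that span \<open>S \<inter> M\<close> modulo the lineality space yields constraints \<open>J\<close> whose functionals vanish on \<open>S \<inter> M\<close>; their extensions
  by zero along \<open>M\<close> describe the sum inside the closed affine space \<open>a + S + M\<close>.
\<close>

lemma generalized_polyhedral_convex_plus_closed_subspace:
  fixes M :: "'a::locally_convex_t2_space set"
  assumes S: "subspace S" and I: "constraints I"
    and M: "subspace M" "closed M" "S \<inter> common_kernel (fst ` I) \<subseteq> M"
  shows "generalized_polyhedral_convex {d + m | d m. (d - a \<in> S \<and> d \<in> solutions I) \<and> m \<in> M}"
proof -
  note fin = constraintsD(2,3)[OF I]
  obtain B where B: "finite B" "B \<subseteq> S \<inter> M"
    "S \<inter> M = {x + y | x y. x \<in> (S \<inter> M) \<inter> common_kernel (fst ` I) \<and> y \<in> span B}"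
    using finite_codimension_common_kernel[OF fin subspace_inter[OF S M(1)]] by blast
  have spanB: "span B \<subseteq> S \<inter> M" by (rule span_minimal[OF B(2) subspace_inter[OF S M(1)]])
  obtain J where J: "constraints J" "\<And>z. z \<in> solutions J \<longleftrightarrow> (\<exists>u\<in>span B. z + u \<in> solutions I)"
    "B \<union> common_kernel (fst ` I) \<subseteq> common_kernel (fst ` J)"
    using Fourier_Motzkin_span[OF B(1) I] by blast
  have kerJ: "subspace (common_kernel (fst ` J))"
    using constraintsD(3)[OF J(1)] by (rule subspace_common_kernel)
  then have "span B \<subseteq> common_kernel (fst ` J)" using J(3) by (simp add: span_minimal)
  then have SM: "S \<inter> M \<subseteq> common_kernel (fst ` J)"
    using J(3) kerJ by (subst B(3)) (auto intro!: subspace_add)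
  have "\<exists>g. continuous_functional g \<and> (\<forall>x\<in>M. g x = 0) \<and> (\<forall>x\<in>S. g x = fst p x)" if "p \<in> J" for p
    using extend_functional_by_zero[OF fin S M, of "fst p"] constraintsD(3)[OF J(1), of "fst p"] that SM
    by (auto simp: common_kernel_def)
  then obtain g where g: "\<And>p. p \<in> J \<Longrightarrow> continuous_functional (g p)"
    "\<And>p x. p \<in> J \<Longrightarrow> x \<in> M \<Longrightarrow> g p x = 0" "\<And>p x. p \<in> J \<Longrightarrow> x \<in> S \<Longrightarrow> g p x = fst p x"
    by metis
  define N where "N = {x + y | x y. x \<in> S \<and> y \<in> M}"
  define L where "L = (\<lambda>z. z - a) -` N"
  have N: "subspace N" "closed N"
    unfolding N_def using subspace_sums[OF S M(1)] closed_plus_finite_codimension[OF fin S M] .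
  have "affine L"
  proof -
    have "L = (+) a ` N" by (simp add: L_def translation_eq_vimage)
    then show ?thesis using N(1) affine_translation[of N a] by (simp add: subspace_imp_affine)
  qed
  moreover have "closed L" unfolding L_def by (intro closed_vimage N continuous_intros)
  \<comment> \<open>The extension \<open>g p\<close> agrees with the functional of \<open>p\<close> on differences from \<open>a\<close> only, so the
      bound is shifted by the discrepancy of the two at \<open>a\<close>.\<close>
  moreover define K where "K = (\<lambda>p. (g p, snd p - fst p a + g p a)) ` J"
  have "constraints K" using g(1) constraintsD(1)[OF J(1)] by (auto simp: constraints_def K_def)
  moreover have "{d + m | d m. (d - a \<in> S \<and> d \<in> solutions I) \<and> m \<in> M} = L \<inter> solutions K"
  proof (intro equalityI subsetI)
    fix z assume "z \<in> {d + m | d m. (d - a \<in> S \<and> d \<in> solutions I) \<and> m \<in> M}"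
    then obtain d m where z: "z = d + m" "d - a \<in> S" "d \<in> solutions I" "m \<in> M" by blast
    have "z - a = (d - a) + m" using z by simp
    then have "z \<in> L" using z(2,4) unfolding L_def N_def by blast
    moreover have "d \<in> solutions J" unfolding J(2) using z(3) span_0 by (metis add.right_neutral)
    then have "g p z \<le> snd p - fst p a + g p a" if p: "p \<in> J" for p
    proof -
      have "fst p d \<le> snd p" using \<open>d \<in> solutions J\<close> p by (auto simp: solutions_def)
      moreover have "continuous_functional (fst p)" using constraintsD(3)[OF J(1)] p by simp
      moreover have "g p (d - a) = fst p (d - a)" "g p m = 0" using g p z by auto
      ultimately show ?thesis
        using g(1)[OF p] z(1) by (simp add: continuous_functionalD)
    qed
    ultimately show "z \<in> L \<inter> solutions K" by (auto simp: solutions_def K_def)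
  next
    fix z assume z: "z \<in> L \<inter> solutions K"
    then obtain s m where sm: "z - a = s + m" "s \<in> S" "m \<in> M" by (auto simp: L_def N_def)
    have "fst p (a + s) \<le> snd p" if p: "p \<in> J" for p
    proof -
      have "g p z \<le> snd p - fst p a + g p a" using z p by (auto simp: solutions_def K_def)
      moreover have "continuous_functional (fst p)" using constraintsD(3)[OF J(1)] p by simp
      moreover have "g p (z - a) = fst p s" unfolding sm(1)
        using g p sm by (simp add: continuous_functionalD(3)[OF g(1)[OF p]])
      ultimately show ?thesis
        using g(1)[OF p] by (simp add: continuous_functionalD)
    qed
    then have "a + s \<in> solutions J" by (auto simp: solutions_def)
    then obtain u where u: "u \<in> span B" "a + s + u \<in> solutions I" unfolding J(2) by blast
    have uSM: "u \<in> S" "u \<in> M" using u spanB by auto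
    have "z = (a + s + u) + (m - u)" using sm(1) by (simp add: algebra_simps)
    moreover have "a + s + u - a \<in> S" using sm uSM S by (simp add: subspace_add)
    moreover have "m - u \<in> M" using sm uSM M(1) by (simp add: subspace_diff)
    ultimately show "z \<in> {d + m | d m. (d - a \<in> S \<and> d \<in> solutions I) \<and> m \<in> M}"
      using u by blast
  qed
  ultimately show ?thesis unfolding generalized_polyhedral_convex_iff by blast
qed

lemma subspace_closure:
  fixes V :: "'a::topological_real_vector set"
  assumes "subspace V"
  shows "subspace (closure V)"
proof (rule subspaceI)
  show "0 \<in> closure V" using subspace_0[OF assms] closure_subset by blast
  fix x y c assume x: "x \<in> closure V" 
  have "(\<lambda>x. c *\<^sub>R x) ` closure V \<subseteq> closure V"
    using subspace_scale[OF assms] closure_subset[of V]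
    by (intro image_closure_subset continuous_on_scaleR_tvs continuous_intros) auto
  with x show "c *\<^sub>R x \<in> closure V" by blast
  assume y: "y \<in> closure V"
  have "(\<lambda>p. fst p + snd p) ` closure (V \<times> V) \<subseteq> closure V"
    using subspace_add[OF assms] closure_subset[of V]
    by (intro image_closure_subset continuous_intros) auto
  then show "x + y \<in> closure V" using x y by (force simp: closure_Times)
qed

text \<open>
  The sum \<open>D + V\<close> itself may fail to be closed, because \<open>R + V\<close> may, where \<open>R\<close> is the lineality
  space of \<open>D\<close>. That is the only obstruction: since \<open>D + R = D\<close>, the closure replaces
  \<open>R + V\<close> by its closure and changes nothing else.
\<close>

theorem generalized_polyhedral_convex_closure_plus_subspace:
  fixes D :: "'a::locally_convex_t2_space set"
  assumes D: "generalized_polyhedral_convex D" and V: "subspace V"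
  shows "generalized_polyhedral_convex (closure {d + v | d v. d \<in> D \<and> v \<in> V})"
    (is "generalized_polyhedral_convex (closure ?DV)")
proof (cases "D = {}")
  case True
  then show ?thesis by (simp add: generalized_polyhedral_convex_empty)
next
  case False
  obtain L I where L: "affine L" "closed L" "constraints I" "D = L \<inter> solutions I"
    using D unfolding generalized_polyhedral_convex_iff by blast
  obtain a where a: "a \<in> L" using False L by blast
  define S where "S = {x - a | x. x \<in> L}"
  have S: "subspace S"
    using affine_diffs_subspace_subtract[OF L(1) a] by (simp add: S_def Setcompr_eq_image)
  have L_iff: "x \<in> L \<longleftrightarrow> x - a \<in> S" for x by (auto simp: S_def)
  define R where "R = S \<inter> common_kernel (fst ` I)"
  have R: "subspace R"
    unfolding R_def using S subspace_common_kernel[OF constraintsD(3)[OF L(3)]] by (rule subspace_inter)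
  have D_R: "d + r \<in> D" if "d \<in> D" "r \<in> R" for d r
  proof -
    have "d - a + r \<in> S" using that L S by (auto simp: R_def L_iff intro: subspace_add)
    then have "d + r \<in> L" by (simp add: L_iff algebra_simps)
    moreover have "f (d + r) \<le> c" if "(f, c) \<in> I" for f c
    proof -
      have "f (d + r) = f d + f r" using constraintsD(4)[OF L(3) that] by (rule continuous_functionalD)
      moreover have "f r = 0" using \<open>r \<in> R\<close> that by (force simp: R_def common_kernel_def)
      ultimately show ?thesis using \<open>d \<in> D\<close> that by (auto simp: L(4) solutions_def)
    qed
    ultimately show ?thesis by (auto simp: L(4) solutions_def)
  qed
  define RV where "RV = {r + v | r v. r \<in> R \<and> v \<in> V}"
  define M where "M = closure RV"
  have RV: "subspace RV" unfolding RV_def using R V by (rule subspace_sums)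
  have M: "subspace M" "closed M" unfolding M_def using RV by (auto intro: subspace_closure)
  have "R \<subseteq> RV" using subspace_0[OF V] by (force simp: RV_def)
  then have "R \<subseteq> M" using closure_subset by (auto simp: M_def)
  have "V \<subseteq> RV" using subspace_0[OF R] by (force simp: RV_def)
  then have VM: "V \<subseteq> M" using closure_subset by (auto simp: M_def)
  define DM where "DM = {d + m | d m. (d - a \<in> S \<and> d \<in> solutions I) \<and> m \<in> M}"
  have DM: "generalized_polyhedral_convex DM"
    unfolding DM_def using S L(3) M \<open>R \<subseteq> M\<close>
    by (intro generalized_polyhedral_convex_plus_closed_subspace) (auto simp: R_def)
  have D_eq: "d - a \<in> S \<and> d \<in> solutions I \<longleftrightarrow> d \<in> D" for d by (simp add: L(4) L_iff)
  have "?DV \<subseteq> DM" unfolding DM_def D_eq using VM by blast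
  then have "closure ?DV \<subseteq> DM"
    using generalized_polyhedral_convex_imp_closed[OF DM] by (rule closure_minimal)
  moreover have "DM \<subseteq> closure ?DV"
  proof
    fix z assume "z \<in> DM"
    then obtain d m where z: "z = d + m" "d \<in> D" "m \<in> M" unfolding DM_def D_eq by blast
    have "d + x \<in> ?DV" if "x \<in> RV" for x
    proof -
      obtain r v where rv: "x = r + v" "r \<in> R" "v \<in> V" using \<open>x \<in> RV\<close> by (auto simp: RV_def)
      then have "d + x = (d + r) + v" by (simp add: add.assoc)
      then show ?thesis using D_R[OF z(2)] rv by blast
    qed
    then have "(+) d ` closure RV \<subseteq> closure ?DV"
      using closure_subset[of ?DV] by (intro image_closure_subset continuous_intros) blast+
    then show "z \<in> closure ?DV" using z by (auto simp: M_def)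
  qed
  ultimately show ?thesis using DM by simp
qed

section \<open>The optimal value function\<close>

theorem theorem4p7:
  fixes \<phi> :: "'x::locally_convex_t2_space \<times> 'y::locally_convex_t2_space \<Rightarrow> ereal"
    and F :: "'x \<Rightarrow> 'y set"
    and \<mu> :: "'x \<Rightarrow> ereal"
  assumes "generalized_polyhedral_convex_fun \<phi>"
    and "generalized_polyhedral_convex_multifun F"
    and "\<mu> = optimal_value \<phi> F"
  shows "generalized_polyhedral_convex_fun \<mu> \<longleftrightarrow> lower_semicontinuous \<mu>"
proof
  assume "generalized_polyhedral_convex_fun \<mu>"
  then show "lower_semicontinuous \<mu>"
    unfolding generalized_polyhedral_convex_fun_def lower_semicontinuous_def
    by (rule generalized_polyhedral_convex_imp_closed)
next
  assume "lower_semicontinuous \<mu>"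
  then have closed: "closed (epi \<mu>)" by (simp add: lower_semicontinuous_def)
  define D where "D = epi \<phi> \<inter> fst -` gph F"
  have "generalized_polyhedral_convex D"
    unfolding D_def using assms(1,2)
    by (intro generalized_polyhedral_convex_Int generalized_polyhedral_convex_vimage
        linear_fst continuous_intros)
      (auto simp: generalized_polyhedral_convex_fun_def generalized_polyhedral_convex_multifun_def)
  moreover define V :: "(('x \<times> 'y) \<times> real) set" where "V = {((0, y), 0) | y. True}"
  have V: "subspace V"
    by (auto simp: V_def subspace_def zero_prod_def)
  moreover define DV where "DV = {d + v | d v. d \<in> D \<and> v \<in> V}"
  ultimately have gpc: "generalized_polyhedral_convex (closure DV)"
    using generalized_polyhedral_convex_closure_plus_subspace by blast
  have DV_iff: "((x, y), t) \<in> DV \<longleftrightarrow> (\<exists>y'\<in>F x. \<phi> (x, y') \<le> ereal t)" for x y t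
  proof
    assume "\<exists>y'\<in>F x. \<phi> (x, y') \<le> ereal t"
    then obtain y' where y': "((x, y'), t) \<in> D" by (auto simp: D_def epi_def gph_def)
    have "((x, y), t) = ((x, y'), t) + ((0, y - y'), 0)" by simp
    then show "((x, y), t) \<in> DV" unfolding DV_def V_def using y' by blast
  qed (auto simp: DV_def V_def D_def epi_def gph_def)
  \<comment> \<open>The epigraph of \<open>\<mu>\<close>, made cylindrical in the \<open>y\<close> coordinate, lies in the space of
      \<open>D + V\<close>.\<close>
  define E :: "(('x \<times> 'y) \<times> real) set" where "E = (\<lambda>p. (fst (fst p), snd p)) -` epi \<mu>"
  have E_iff: "((x, y), t) \<in> E \<longleftrightarrow> \<mu> x \<le> ereal t" for x y t by (simp add: E_def epi_def)
  have "closed E" unfolding E_def by (intro closed_vimage closed continuous_intros)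
  moreover have "DV \<subseteq> E"
    by (auto simp: DV_iff E_iff assms(3) optimal_value_def intro: INF_lower2)
  ultimately have "closure DV \<subseteq> E" by (rule closure_minimal[rotated])
  moreover have "E \<subseteq> closure DV"
  proof clarify
    fix x y t assume "((x, y), t) \<in> E"
    then have le: "\<mu> x \<le> ereal t" by (simp add: E_iff)
    \<comment> \<open>The infimum need not be attained, but any larger bound is.\<close>
    have "((x, y), t + inverse (real (Suc n))) \<in> DV" for n
    proof -
      have "\<mu> x < ereal (t + inverse (real (Suc n)))" using le by (rule le_less_trans) simp
      then show ?thesis unfolding DV_iff assms(3) optimal_value_def INF_less_iff
        by (blast intro: less_imp_le)
    qed
    moreover have "(\<lambda>n. ((x, y), t + inverse (real (Suc n)))) \<longlonglongrightarrow> ((x, y), t + 0)"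
      by (intro tendsto_intros LIMSEQ_inverse_real_of_nat)
    ultimately have "((x, y), t + 0) \<in> closure DV"
      using closure_subset[of DV]
      by (intro Lim_in_closed_set[of "closure DV" _ sequentially]) (auto simp: eventually_sequentially)
    then show "((x, y), t) \<in> closure DV" by simp
  qed
  ultimately have "generalized_polyhedral_convex E" using gpc by simp
  then have "generalized_polyhedral_convex ((\<lambda>p::'x \<times> real. ((fst p, 0::'y), snd p)) -` E)"
    by (rule generalized_polyhedral_convex_vimage)
      (auto simp: linear_iff intro!: continuous_intros)
  moreover have "(\<lambda>p::'x \<times> real. ((fst p, 0::'y), snd p)) -` E = epi \<mu>"
    by (auto simp: E_iff epi_def)
  ultimately show "generalized_polyhedral_convex_fun \<mu>"
    by (simp add: generalized_polyhedral_convex_fun_def)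
qed

end
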